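(* Every coarsely amenable metric space $X$ is uniformly locally amenable with respect to probability measures (has property ULA$_\mu$).
   Context: Let $X$ be a metric space with metric $d$; $B(x,r)=\{y:d(x,y)<r\}$ is the $r$-ball at $x$. A cover $\mathcal{U}$ of $X$ is a family of subsets of $X$ with union $X$. Its diameter is the infimum of all $r$ with $0\le r\le\infty$ such that $d(x,y)<r$ whenever $x,y$ belong to the same element of $\mathcal{U}$; $\mathcal{U}$ is uniformly bounded if its diameter is finite. For $A\subset X$, the horizon of $A$ is $\operatorname{hor}(A,\mathcal{U})=\{U\in\mathcal{U}: A\cap U\neq\emptyset\}$. $X$ is coarsely amenable if for each $s>r>0$ and each $\epsilon>0$ there is a uniformly bounded cover $\mathcal{U}$ of $X$ such that for each $x\in X$ the horizon $\operatorname{hor}(B(x,s),\mathcal{U})$ is finite and $\frac{|\operatorname{hor}(B(x,r),\mathcal{U})|}{|\operatorname{hor}(B(x,s),\mathcal{U})|}>1-\epsilon$. For $R>0$ and $E\subset X$, the $R$-boundary $\partial_R E$ of $E$ is the set of points in $X\setminus E$ of distance less than $R$ to $E$. $X$ has property ULA$_\mu$ (uniform local amenability with respect to probability measures) if for all $R,\epsilon>0$ there exists $S>0$ such that for all probability measures $\lambda$ on $X$ there exists a finite subset $E$ of $X$ of diameter at most $S$ satisfying $\lambda(\partial_R E)<\epsilon\cdot\lambda(E)$.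
   Formalization: "Probability measures on X" is restricted to discrete (purely atomic) ones; for arbitrary measures the claim fails, e.g. Lebesgue measure on [0,1], where every finite E has measure 0. *)

theory Defs
  imports "HOL-Probability.Probability"
begin

definition is_cover :: "'a set \<Rightarrow> 'a set set \<Rightarrow> bool" where
  "is_cover M \<U> \<longleftrightarrow> (\<forall>U\<in>\<U>. U \<subseteq> M) \<and> \<Union>\<U> = M"

text \<open>The infimum is taken over \<open>[0, \<infinity>]\<close>, so that unbounded covers have diameter \<open>\<infinity>\<close>.\<close>

definition cover_diameter :: "('a \<Rightarrow> 'a \<Rightarrow> real) \<Rightarrow> 'a set set \<Rightarrow> ennreal" where
  "cover_diameter d \<U> = Inf {r. \<forall>U\<in>\<U>. \<forall>x\<in>U. \<forall>y\<in>U. ennreal (d x y) < r}"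

definition uniformly_bounded :: "('a \<Rightarrow> 'a \<Rightarrow> real) \<Rightarrow> 'a set set \<Rightarrow> bool" where
  "uniformly_bounded d \<U> \<longleftrightarrow> cover_diameter d \<U> < \<infinity>"

definition hor :: "'a set \<Rightarrow> 'a set set \<Rightarrow> 'a set set" where
  "hor A \<U> = {U \<in> \<U>. A \<inter> U \<noteq> {}}"

definition coarsely_amenable :: "'a set \<Rightarrow> ('a \<Rightarrow> 'a \<Rightarrow> real) \<Rightarrow> bool" where
  "coarsely_amenable M d \<longleftrightarrow>
    (\<forall>s r \<epsilon>. s > r \<and> r > 0 \<and> \<epsilon> > 0 \<longrightarrow>
      (\<exists>\<U>. is_cover M \<U> \<and> uniformly_bounded d \<U> \<and>
        (\<forall>x\<in>M. finite (hor (Metric_space.mball M d x s) \<U>) \<and>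
          real (card (hor (Metric_space.mball M d x r) \<U>)) /
          real (card (hor (Metric_space.mball M d x s) \<U>)) > 1 - \<epsilon>)))"

text \<open>Distances to sets and diameters of sets are \<open>[0, \<infinity>]\<close>-valued: every point has distance
  \<open>\<infinity>\<close> to the empty set, and the empty set has diameter \<open>0\<close>.\<close>

definition dist_to_set :: "('a \<Rightarrow> 'a \<Rightarrow> real) \<Rightarrow> 'a \<Rightarrow> 'a set \<Rightarrow> ennreal" where
  "dist_to_set d x E = (INF e\<in>E. ennreal (d x e))"

definition set_diameter :: "('a \<Rightarrow> 'a \<Rightarrow> real) \<Rightarrow> 'a set \<Rightarrow> ennreal" where
  "set_diameter d E = (SUP x\<in>E. SUP y\<in>E. ennreal (d x y))"

definition R_boundary :: "'a set \<Rightarrow> ('a \<Rightarrow> 'a \<Rightarrow> real) \<Rightarrow> real \<Rightarrow> 'a set \<Rightarrow> 'a set" where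
  "R_boundary M d R E = {x \<in> M - E. dist_to_set d x E < ennreal R}"

text \<open>Probability measures are discrete (atomic) ones, as is usual in coarse geometry: a
  probability mass function concentrated on \<open>M\<close>. This cannot be relaxed to, say, arbitrary Borel
  probability measures, because the sets \<open>E\<close> are finite: on a bounded space, taking \<open>R\<close> larger
  than its diameter, the condition forces finite sets of measure arbitrarily close to \<open>1\<close>.\<close>

definition ULA_mu :: "'a set \<Rightarrow> ('a \<Rightarrow> 'a \<Rightarrow> real) \<Rightarrow> bool" where
  "ULA_mu M d \<longleftrightarrow>
    (\<forall>R \<epsilon> :: real. R > 0 \<and> \<epsilon> > 0 \<longrightarrow>
      (\<exists>S > 0. \<forall>\<mu> :: 'a pmf. set_pmf \<mu> \<subseteq> M \<longrightarrow>
        (\<exists>E. E \<subseteq> M \<and> finite E \<and> set_diameter d E \<le> ennreal S \<and>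
          measure_pmf.prob \<mu> (R_boundary M d R E) < \<epsilon> * measure_pmf.prob \<mu> E)))"

end

theory Submission
  imports Defs
begin

text \<open>Let \<open>h x\<close> and \<open>h' x\<close> be the sizes of the horizons of the balls of radius \<open>R\<close> and \<open>2 * R\<close>
  at \<open>x\<close>, for a cover with \<open>h' \<le> q * h\<close> and \<open>q\<close> close to \<open>1\<close>. The candidate sets \<open>E\<close> are the
  \<open>R\<close>-neighbourhoods of the members of the cover. Summed over the cover, the measures of these
  neighbourhoods give the integral of \<open>h\<close>, and those of the boundaries at most the integral of
  \<open>h' - h\<close>, so some member would do if \<open>h\<close> were integrable. In general one cuts the neighbourhoods
  down to \<open>{h \<le> t}\<close>. Since \<open>h y \<le> h' x \<le> q * h x\<close> whenever \<open>d x y < R\<close>, this adds only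
  points with \<open>h \<le> q * t\<close> to the boundaries. The truncated integral \<open>G t\<close> of \<open>h\<close> over \<open>{h \<le> t}\<close>
  is at most \<open>t\<close>, hence \<open>G (q * t) < q\<^sup>2 * G t\<close> for some \<open>t\<close>, and the sum of the boundary measures
  is at most \<open>q * G (q * t) - G t < (q ^ 3 - 1) * G t\<close>. Finally, one passes to a finite subset of
  the support that carries almost all of the measure.\<close>

text \<open>The support is countable: its points with enumeration index below \<open>n\<close> form
  finite sets increasing to it, and continuity from below applies.\<close>

lemma pmf_finite_tight:
  fixes \<mu> :: "'a pmf"
  assumes "\<eta> > 0"
  obtains F where "finite F" "F \<subseteq> set_pmf \<mu>" "measure_pmf.prob \<mu> (- F) < \<eta>"
proof -
  define A where "A n = {x \<in> set_pmf \<mu>. to_nat_on (set_pmf \<mu>) x < n}" for n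
  have inj: "inj_on (to_nat_on (set_pmf \<mu>)) (set_pmf \<mu>)"
    by (simp add: inj_on_to_nat_on)
  have fin: "finite (A n)" for n
    by (rule inj_on_finite[of "to_nat_on (set_pmf \<mu>)" _ "{..<n}"])
      (use inj in \<open>auto simp: A_def inj_on_def\<close>)
  have "(\<lambda>n. measure_pmf.prob \<mu> (A n)) \<longlonglongrightarrow> measure_pmf.prob \<mu> (\<Union>n. A n)"
    by (intro measure_pmf.finite_Lim_measure_incseq) (auto simp: A_def incseq_def)
  also have "(\<Union>n. A n) = set_pmf \<mu>"
    by (auto simp: A_def)
  also have "measure_pmf.prob \<mu> (set_pmf \<mu>) = 1"
    by (simp add: measure_pmf.prob_eq_1 AE_measure_pmf)
  finally have "eventually (\<lambda>n. 1 - \<eta> < measure_pmf.prob \<mu> (A n)) sequentially"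
    by (rule order_tendstoD) (use assms in simp)
  then obtain n where "1 - \<eta> < measure_pmf.prob \<mu> (A n)"
    by (meson eventually_happens sequentially_bot)
  moreover have "measure_pmf.prob \<mu> (- A n) = 1 - measure_pmf.prob \<mu> (A n)"
    using measure_pmf.prob_compl[of "A n" \<mu>] by (simp add: Compl_eq_Diff_UNIV)
  ultimately show thesis
    using that[of "A n"] fin by (auto simp: A_def)
qed

text \<open>Double counting: exchanging the finite sum with the integral turns measures summed over
  a cover into the integral of a horizon size.\<close>

lemma sum_prob_eq_expectation_card:
  fixes \<mu> :: "'a pmf"
  assumes "finite V"
  shows "(\<Sum>U\<in>V. measure_pmf.prob \<mu> {x. P U x}) =
    measure_pmf.expectation \<mu> (\<lambda>x. real (card {U \<in> V. P U x}))"
proof -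
  have "(\<Sum>U\<in>V. measure_pmf.prob \<mu> {x. P U x}) =
      (\<Sum>U\<in>V. measure_pmf.expectation \<mu> (indicator {x. P U x}))"
    by simp
  also have "\<dots> = measure_pmf.expectation \<mu> (\<lambda>x. \<Sum>U\<in>V. indicator {x. P U x} x)"
    by (rule Bochner_Integration.integral_sum[symmetric])
      (auto intro!: measure_pmf.integrable_const_bound[where B = 1])
  also have "(\<lambda>x. \<Sum>U\<in>V. indicator {x. P U x} x) = (\<lambda>x. real (card {U \<in> V. P U x}))"
    using assms by (auto simp: indicator_def sum.If_cases Int_def fun_eq_iff)
  finally show ?thesis .
qed

text \<open>Otherwise \<open>G\<close> stays positive along \<open>q ^ k * t0\<close> and grows
  there at least like \<open>q ^ (2 * k)\<close>, which outruns the linear bound.\<close>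

lemma linear_growth_scale:
  fixes G :: "real \<Rightarrow> real"
  assumes "q > 1" "t0 > 0" "G t0 > 0" and le: "\<And>t. t > 0 \<Longrightarrow> G t \<le> t"
  obtains t where "t > 0" "G t > 0" "G (q * t) < q\<^sup>2 * G t"
proof (rule ccontr)
  assume "\<not> thesis"
  then have step: "\<And>t. \<lbrakk>t > 0; G t > 0\<rbrakk> \<Longrightarrow> G (q * t) \<ge> q\<^sup>2 * G t"
    using that by force
  have growth: "G (q ^ k * t0) \<ge> q ^ k * q ^ k * G t0" for k
  proof (induction k)
    case (Suc k)
    have "q ^ k * q ^ k * G t0 > 0"
      using assms by simp
    then have pos: "G (q ^ k * t0) > 0"
      using Suc.IH by (rule less_le_trans)
    have "q ^ Suc k * q ^ Suc k * G t0 = q\<^sup>2 * (q ^ k * q ^ k * G t0)"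
      by (simp add: power2_eq_square)
    also have "\<dots> \<le> q\<^sup>2 * G (q ^ k * t0)"
      using Suc.IH by (simp add: mult_left_mono)
    also have "\<dots> \<le> G (q * (q ^ k * t0))"
      using pos assms by (intro step) auto
    finally show ?case
      by (simp add: mult.assoc)
  qed simp
  obtain k where k: "t0 / G t0 < q ^ k"
    using real_arch_pow assms(1) by blast
  have "q ^ k * (q ^ k * G t0) \<le> q ^ k * t0"
    using order.trans[OF growth[of k] le[of "q ^ k * t0"]] assms by (simp add: mult.assoc)
  then have "q ^ k * G t0 \<le> t0"
    using assms by simp
  with k show False
    using assms by (simp add: field_simps)
qed

text \<open>The averaging argument with the metric stripped away: \<open>H\<close> and
  \<open>H'\<close> stand for the two horizons, the subtracted set becomes \<open>E\<close>, and the
  difference will contain the boundary of \<open>E\<close>.\<close>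

lemma exists_small_relative_boundary:
  fixes \<mu> :: "'a pmf" and H H' :: "'a \<Rightarrow> 'b set"
  assumes fin: "\<And>x. finite (H x)" "\<And>x. finite (H' x)"
    and sub: "\<And>x. H x \<subseteq> H' x"
    and card_le: "\<And>x. real (card (H' x)) \<le> q * real (card (H x))"
    and q: "q > 1" "q ^ 3 < 1 + \<epsilon>"
    and x0: "x0 \<in> set_pmf \<mu>" "H x0 \<noteq> {}"
  obtains t F U where "finite F" "F \<subseteq> set_pmf \<mu>"
    "measure_pmf.prob \<mu> ({y. real (card (H y)) \<le> q * t \<and> U \<in> H' y} -
        {y \<in> F. real (card (H y)) \<le> t \<and> U \<in> H y})
      < \<epsilon> * measure_pmf.prob \<mu> {y \<in> F. real (card (H y)) \<le> t \<and> U \<in> H y}"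
proof -
  define h where "h x = real (card (H x))" for x
  define G where "G t = measure_pmf.expectation \<mu> (\<lambda>x. if h x \<le> t then h x else 0)" for t
  have h0: "h x \<ge> 0" for x
    by (simp add: h_def)
  \<comment> \<open>The truncation at \<open>t\<close> bounds the integrand, whether or not
    \<open>h\<close> itself is integrable.\<close>
  have int: "integrable \<mu> (\<lambda>x. if h x \<le> t \<and> P x then c * h x else 0)" for t P c
    by (intro measure_pmf.integrable_const_bound[where B = "\<bar>c\<bar> * \<bar>t\<bar>"])
      (use h0 in \<open>auto simp: abs_mult intro!: mult_left_mono AE_I2\<close>)
  have int': "integrable \<mu> (\<lambda>x. if h x \<le> t \<and> P x then h x else 0)"
    "integrable \<mu> (\<lambda>x. if h x \<le> t then h x else 0)" for t P
    using int[of t P 1] int[of t "\<lambda>_. True" 1] by (simp_all cong: if_cong)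
  have G_le: "G t \<le> t" if "t > 0" for t
    unfolding G_def
    by (rule measure_pmf.integral_le_const) (use that int' in auto)
  have hx0: "h x0 > 0"
    using x0 fin by (simp add: h_def card_gt_0_iff)
  \<comment> \<open>The atom at \<open>x0\<close> alone makes \<open>G (h x0)\<close> positive, so
    \<open>h x0\<close> can serve as the starting scale.\<close>
  have "pmf \<mu> x0 * h x0 = measure_pmf.expectation \<mu> (\<lambda>x. h x0 * indicator {x0} x)"
    by (simp add: measure_pmf_single)
  also have "\<dots> \<le> G (h x0)"
    unfolding G_def using h0 int'
    by (intro integral_mono measure_pmf.integrable_const_bound[where B = "h x0"])
      (auto simp: indicator_def)
  finally have "G (h x0) > 0"
    using hx0 x0 by (smt (verit) mult_pos_pos pmf_positive)
  then obtain t where t: "t > 0" "G t > 0" "G (q * t) < q\<^sup>2 * G t"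
    using linear_growth_scale[of q "h x0" G] q(1) hx0 G_le by blast
  have "q * G (q * t) < q * (q\<^sup>2 * G t)"
    using t q by simp
  also have "\<dots> = q ^ 3 * G t"
    by (simp add: power3_eq_cube power2_eq_square)
  also have "\<dots> < (1 + \<epsilon>) * G t"
    using t q by simp
  finally have gap: "q * G (q * t) < (1 + \<epsilon>) * G t" .
  have \<epsilon>: "1 + \<epsilon> > 0"
    using q by (smt (verit) zero_less_power)
  \<comment> \<open>Restricting to \<open>F\<close> costs \<open>G t\<close> at most
    \<open>t\<close> times the mass outside \<open>F\<close>; \<open>\<eta>\<close> is the mass at
    which \<open>1 + \<epsilon>\<close> times this loss would use up the slack in
    \<open>gap\<close>.\<close>
  define \<eta> where "\<eta> = ((1 + \<epsilon>) * G t - q * G (q * t)) / ((1 + \<epsilon>) * t)"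
  have "\<eta> > 0"
    using gap \<epsilon> t by (simp add: \<eta>_def)
  then obtain F where F: "finite F" "F \<subseteq> set_pmf \<mu>" "measure_pmf.prob \<mu> (- F) < \<eta>"
    using pmf_finite_tight by blast
  define GF where "GF = measure_pmf.expectation \<mu> (\<lambda>x. if h x \<le> t \<and> x \<in> F then h x else 0)"
  have "G t - GF = measure_pmf.expectation \<mu>
      (\<lambda>x. (if h x \<le> t then h x else 0) - (if h x \<le> t \<and> x \<in> F then h x else 0))"
    unfolding G_def GF_def
    using int'
    by (subst Bochner_Integration.integral_diff) simp_all
  also have "\<dots> \<le> measure_pmf.expectation \<mu> (\<lambda>x. t * indicator (- F) x)"
    using int' t
    by (intro integral_mono measure_pmf.integrable_const_bound[where B = t]
        Bochner_Integration.integrable_diff) (auto simp: indicator_def abs_of_nonneg[OF h0])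
  also have "\<dots> = t * measure_pmf.prob \<mu> (- F)"
    by simp
  also have "\<dots> < t * \<eta>"
    using F t by simp
  finally have "(1 + \<epsilon>) * (G t - GF) < (1 + \<epsilon>) * (t * \<eta>)"
    using \<epsilon> by simp
  also have "\<dots> = (1 + \<epsilon>) * G t - q * G (q * t)"
    using \<epsilon> t by (simp add: \<eta>_def)
  finally have gapF: "q * G (q * t) < (1 + \<epsilon>) * GF"
    by (simp add: algebra_simps)
  \<comment> \<open>A finite family is enough: \<open>E U\<close> is empty for \<open>U\<close>
    outside \<open>V\<close>, so the sum of the \<open>E U\<close> loses nothing, and for the
    \<open>C U\<close> only an upper bound is wanted.\<close>
  define V where "V = (\<Union>y\<in>F. H y)"
  define E where "E U = {y \<in> F. h y \<le> t \<and> U \<in> H y}" for U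
  define C where "C U = {y. h y \<le> q * t \<and> U \<in> H' y}" for U
  have finV: "finite V"
    using F fin by (simp add: V_def)
  have "t \<le> q * t"
    using q t by simp
  then have EC: "E U \<subseteq> C U" for U
    using sub by (auto simp: E_def C_def)
  have sumE: "(\<Sum>U\<in>V. measure_pmf.prob \<mu> (E U)) = GF"
  proof -
    have "real (card {U \<in> V. y \<in> F \<and> h y \<le> t \<and> U \<in> H y}) =
        (if h y \<le> t \<and> y \<in> F then h y else 0)" for y
    proof (cases "h y \<le> t \<and> y \<in> F")
      case True
      then have "{U \<in> V. y \<in> F \<and> h y \<le> t \<and> U \<in> H y} = H y"
        by (auto simp: V_def)
      with True show ?thesis
        by (simp add: h_def)
    qed auto
    then show ?thesis
      unfolding E_def GF_def sum_prob_eq_expectation_card[OF finV] by simp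
  qed
  have sumC: "(\<Sum>U\<in>V. measure_pmf.prob \<mu> (C U)) \<le> q * G (q * t)"
  proof -
    have le: "real (card {U \<in> V. h y \<le> q * t \<and> U \<in> H' y}) \<le>
        (if h y \<le> q * t then q * h y else 0)" for y
    proof (cases "h y \<le> q * t")
      case True
      have "card {U \<in> V. h y \<le> q * t \<and> U \<in> H' y} \<le> card (H' y)"
        by (rule card_mono) (use fin in auto)
      with card_le[of y] True show ?thesis
        by (simp add: h_def)
    qed auto
    have int_qh: "integrable \<mu> (\<lambda>y. if h y \<le> q * t then q * h y else 0)"
      using int[of "q * t" "\<lambda>_. True" q] by simp
    have "(\<Sum>U\<in>V. measure_pmf.prob \<mu> (C U)) \<le>
        measure_pmf.expectation \<mu> (\<lambda>y. if h y \<le> q * t then q * h y else 0)"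
      unfolding C_def sum_prob_eq_expectation_card[OF finV]
    proof (rule integral_mono)
      show "integrable \<mu> (\<lambda>y. real (card {U \<in> V. h y \<le> q * t \<and> U \<in> H' y}))"
        by (rule measure_pmf.integrable_const_bound[where B = "real (card V)"])
          (use finV in \<open>auto intro!: AE_I2 card_mono\<close>)
    qed (use int_qh le in auto)
    also have "\<dots> = measure_pmf.expectation \<mu> (\<lambda>y. q * (if h y \<le> q * t then h y else 0))"
      by (rule Bochner_Integration.integral_cong) auto
    also have "\<dots> = q * G (q * t)"
      by (simp add: G_def)
    finally show ?thesis .
  qed
  \<comment> \<open>If every member failed, summing the reversed inequalities over \<open>V\<close>
    would contradict \<open>gapF\<close>.\<close>
  have "\<exists>U. measure_pmf.prob \<mu> (C U - E U) < \<epsilon> * measure_pmf.prob \<mu> (E U)"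
  proof (rule ccontr)
    assume "\<not> ?thesis"
    then have "(\<Sum>U\<in>V. \<epsilon> * measure_pmf.prob \<mu> (E U)) \<le> (\<Sum>U\<in>V. measure_pmf.prob \<mu> (C U - E U))"
      by (intro sum_mono) (auto simp: not_less)
    also have "\<dots> = (\<Sum>U\<in>V. measure_pmf.prob \<mu> (C U) - measure_pmf.prob \<mu> (E U))"
      using EC by (intro sum.cong measure_pmf.finite_measure_Diff) auto
    also have "\<dots> \<le> q * G (q * t) - GF"
      using sumC sumE by (simp add: sum_subtractf)
    finally have "\<epsilon> * GF \<le> q * G (q * t) - GF"
      using sumE by (simp flip: sum_distrib_left)
    with gapF show False
      by (simp add: algebra_simps)
  qed
  then obtain U where "measure_pmf.prob \<mu> (C U - E U) < \<epsilon> * measure_pmf.prob \<mu> (E U)" ..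
  with F show thesis
    unfolding E_def C_def h_def by (intro that[of F t U])
qed

lemma uniformly_bounded_obtains:
  assumes "uniformly_bounded d \<U>"
  obtains D where "D > 0" "\<And>U x y. \<lbrakk>U \<in> \<U>; x \<in> U; y \<in> U\<rbrakk> \<Longrightarrow> d x y < D"
proof -
  obtain r where r: "r < \<infinity>" "\<And>U x y. \<lbrakk>U \<in> \<U>; x \<in> U; y \<in> U\<rbrakk> \<Longrightarrow> ennreal (d x y) < r"
    using assms unfolding uniformly_bounded_def cover_diameter_def Inf_less_iff by blast
  \<comment> \<open>The summand \<open>1\<close> secures a positive bound: \<open>r\<close> may be
    \<open>0\<close> when the cover has no nonempty member.\<close>
  have "d x y < enn2real r + 1" if "U \<in> \<U>" "x \<in> U" "y \<in> U" for U x y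
  proof -
    have "ennreal (d x y) < ennreal (enn2real r)"
      using r that by simp
    then show ?thesis
      using enn2real_nonneg[of r] by (smt (verit) ennreal_leI not_less)
  qed
  moreover have "enn2real r + 1 > 0"
    using enn2real_nonneg[of r] by linarith
  ultimately show thesis
    using that by blast
qed

theorem theorem8p7:
  fixes M :: "'a set" and d :: "'a \<Rightarrow> 'a \<Rightarrow> real"
  assumes "Metric_space M d"
    and "coarsely_amenable M d"
  shows "ULA_mu M d"
  unfolding ULA_mu_def
proof (intro allI impI)
  interpret Metric_space M d by fact
  fix R \<epsilon> :: real
  assume "R > 0 \<and> \<epsilon> > 0"
  then have R: "R > 0" and \<epsilon>: "\<epsilon> > 0"
    by auto
  \<comment> \<open>The cube of \<open>q\<close> is \<open>1 + \<epsilon> / 2\<close>, strictly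
    between \<open>1\<close> and \<open>1 + \<epsilon>\<close>.\<close>
  define q where "q = root 3 (1 + \<epsilon> / 2)"
  have q: "q > 1" "q ^ 3 < 1 + \<epsilon>"
    using \<epsilon> by (simp_all add: q_def)
  \<comment> \<open>With the error \<open>1 - 1 / q\<close> the ratio of the horizon sizes exceeds
    \<open>1 / q\<close>, which is the bound \<open>h' \<le> q * h\<close>.\<close>
  have "2 * R > R \<and> R > 0 \<and> 1 - 1 / q > 0"
    using R q by simp
  then obtain \<U> where \<U>: "is_cover M \<U>" "uniformly_bounded d \<U>"
    and hor: "\<And>x. x \<in> M \<Longrightarrow> finite (hor (mball x (2 * R)) \<U>) \<and>
      real (card (hor (mball x R) \<U>)) / real (card (hor (mball x (2 * R)) \<U>)) > 1 - (1 - 1 / q)"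
    using assms(2) unfolding coarsely_amenable_def by blast
  obtain D where D: "D > 0" "\<And>U x y. \<lbrakk>U \<in> \<U>; x \<in> U; y \<in> U\<rbrakk> \<Longrightarrow> d x y < D"
    using uniformly_bounded_obtains[OF \<U>(2)] by metis
  define H where "H x = hor (mball x R) \<U>" for x
  define H' where "H' x = hor (mball x (2 * R)) \<U>" for x
  have sub: "H x \<subseteq> H' x" for x
    using R by (fastforce simp: H_def H'_def hor_def)
  \<comment> \<open>A ball centred outside \<open>M\<close> is empty, so the estimates extend to all
    points of the type, as the averaging lemma demands.\<close>
  have outside: "H' x = {}" if "x \<notin> M" for x
    using that by (auto simp: H'_def hor_def)
  have fin': "finite (H' x)" for x
    using hor[of x] outside[of x] by (cases "x \<in> M") (auto simp: H'_def)
  then have fin: "finite (H x)" for x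
    using sub finite_subset by blast
  have card_le: "real (card (H' x)) \<le> q * real (card (H x))" for x
  proof (cases "x \<in> M")
    case True
    then have "real (card (H x)) / real (card (H' x)) > 1 / q"
      using hor by (auto simp: H_def H'_def)
    then show ?thesis
      using q by (cases "card (H' x) = 0") (auto simp: field_simps)
  next
    case False
    then show ?thesis
      using outside q by simp
  qed
  \<comment> \<open>Used in both directions for \<open>x\<close> in \<open>E\<close> and
    \<open>y\<close> in its boundary: once to put \<open>U\<close> into \<open>H' y\<close>, once to
    bound the size of \<open>H y\<close> by that of \<open>H' x\<close>.\<close>
  have near: "H x \<subseteq> H' y" if "x \<in> M" "y \<in> M" "d y x < R" for x y
  proof
    fix U
    assume "U \<in> H x"
    then obtain z where z: "U \<in> \<U>" "z \<in> U" "z \<in> M" "d x z < R"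
      by (auto simp: H_def hor_def)
    then have "d y z < 2 * R"
      using triangle[of y x z] that by linarith
    with z that show "U \<in> H' y"
      by (auto simp: H'_def hor_def)
  qed
  show "\<exists>S>0. \<forall>\<mu>. set_pmf \<mu> \<subseteq> M \<longrightarrow>
      (\<exists>E\<subseteq>M. finite E \<and> set_diameter d E \<le> ennreal S \<and>
        measure_pmf.prob \<mu> (R_boundary M d R E) < \<epsilon> * measure_pmf.prob \<mu> E)"
  \<comment> \<open>Each point of \<open>E\<close> is within \<open>R\<close> of a point of one
    cover member, whose points are less than \<open>D\<close> apart; \<open>D\<close> depends on the
    cover only, not on \<open>\<mu>\<close>.\<close>
  proof (intro exI[of _ "D + 2 * R"] conjI allI impI)
    show "D + 2 * R > 0"
      using D R by simp
    fix \<mu> :: "'a pmf"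
    assume \<mu>: "set_pmf \<mu> \<subseteq> M"
    obtain x0 where x0: "x0 \<in> set_pmf \<mu>"
      using set_pmf_not_empty[of \<mu>] by blast
    then have "x0 \<in> mball x0 R"
      using \<mu> R by auto
    moreover obtain U0 where "U0 \<in> \<U>" "x0 \<in> U0"
      using \<U>(1) \<mu> x0 by (auto simp: is_cover_def)
    ultimately have "U0 \<in> H x0"
      unfolding H_def hor_def by blast
    then have "H x0 \<noteq> {}"
      by blast
    then obtain t F U where F: "finite F" "F \<subseteq> set_pmf \<mu>" and
      less: "measure_pmf.prob \<mu> ({y. real (card (H y)) \<le> q * t \<and> U \<in> H' y} -
          {y \<in> F. real (card (H y)) \<le> t \<and> U \<in> H y})
        < \<epsilon> * measure_pmf.prob \<mu> {y \<in> F. real (card (H y)) \<le> t \<and> U \<in> H y}"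
      by (rule exists_small_relative_boundary[OF fin fin' sub card_le q x0])
    define E where "E = {y \<in> F. real (card (H y)) \<le> t \<and> U \<in> H y}"
    have EM: "E \<subseteq> M"
      using F \<mu> by (auto simp: E_def)
    have "set_diameter d E \<le> ennreal (D + 2 * R)"
      unfolding set_diameter_def
    proof (intro SUP_least ennreal_leI)
      fix x y
      assume xy: "x \<in> E" "y \<in> E"
      then obtain u v where "U \<in> \<U>" "u \<in> U" "u \<in> M" "d x u < R" "v \<in> U" "v \<in> M" "d y v < R"
        by (auto simp: E_def H_def hor_def)
      then show "d x y \<le> D + 2 * R"
        using triangle[of x u y] triangle[of u v y] D(2)[of U u v] commute[of v y] xy EM
        by fastforce
    qed
    moreover have "R_boundary M d R E \<subseteq> {y. real (card (H y)) \<le> q * t \<and> U \<in> H' y} - E"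
    proof
      fix y
      assume "y \<in> R_boundary M d R E"
      then obtain x where y: "y \<in> M" "y \<notin> E" and x: "x \<in> E" "ennreal (d y x) < ennreal R"
        by (auto simp: R_boundary_def dist_to_set_def INF_less_iff)
      then have dist: "d y x < R" "d x y < R"
        using ennreal_less_iff[of "d y x" R] nonneg commute[of x y] by auto
      have "x \<in> M"
        using x EM by blast
      have "real (card (H y)) \<le> real (card (H' x))"
        using near[of y x] dist y \<open>x \<in> M\<close> fin' by (simp add: card_mono)
      also have "\<dots> \<le> q * real (card (H x))"
        by (rule card_le)
      also have "\<dots> \<le> q * t"
        using x q by (simp add: E_def)
      finally show "y \<in> {y. real (card (H y)) \<le> q * t \<and> U \<in> H' y} - E"
        using near[of x y] dist y x \<open>x \<in> M\<close> by (auto simp: E_def)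
    qed
    then have "measure_pmf.prob \<mu> (R_boundary M d R E) \<le>
        measure_pmf.prob \<mu> ({y. real (card (H y)) \<le> q * t \<and> U \<in> H' y} - E)"
      by (intro measure_pmf.finite_measure_mono) auto
    then have "measure_pmf.prob \<mu> (R_boundary M d R E) < \<epsilon> * measure_pmf.prob \<mu> E"
      using less unfolding E_def by linarith
    moreover have "finite E"
      using F by (simp add: E_def)
    ultimately show "\<exists>E\<subseteq>M. finite E \<and> set_diameter d E \<le> ennreal (D + 2 * R) \<and>
        measure_pmf.prob \<mu> (R_boundary M d R E) < \<epsilon> * measure_pmf.prob \<mu> E"
      using EM by blast
  qed
qed

end
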